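(* Let $R$ be a quasiorder on a non-empty set $U$ and let $$\mathcal{J}=\{(\emptyset,\{x\}^{\blacktriangle})\mid x\in U,\ |R(x)|\geq 2\}\cup\{(\{x\}^{\vartriangle},\{x\}^{\vartriangle\blacktriangle})\mid x\in U\}.$$ Then $\mathcal{J}$ is the set of completely join-irreducible elements of the complete lattice $\mathcal{RS}$. Any nonzero element of $\mathcal{RS}$ is a join of some completely join-irreducible elements of $\mathcal{J}$.
   Context: A quasiorder is a reflexive and transitive binary relation. For $x\in U$, $R(x)=\{y\in U\mid x\,R\,y\}$ and $R^{-1}(x)=\{y\in U\mid y\,R\,x\}$. For $X\subseteq U$, $X^{\blacktriangledown}=\{x\in U\mid R(x)\subseteq X\}$, $X^{\blacktriangle}=\{x\in U\mid R(x)\cap X\neq\emptyset\}$, and $X^{\vartriangle}=\{x\in U\mid R^{-1}(x)\cap X\neq\emptyset\}$. Stacked superscripts are applied from left to right, so $\{x\}^{\vartriangle\blacktriangle}=(\{x\}^{\vartriangle})^{\blacktriangle}$. The rough set of $X$ is $\mathcal{A}(X)=(X^{\blacktriangledown},X^{\blacktriangle})$, $RS=\{\mathcal{A}(X)\mid X\subseteq U\}$, and $\mathcal{RS}=(RS,\leq)$ with $\leq$ the coordinatewise inclusion order on pairs of sets; for a quasiorder $R$ on a non-empty set this is a complete lattice with coordinatewise unions and intersections as joins and meets and with least element (zero) $(\emptyset,\emptyset)$. An element $x$ of a complete lattice $L$ is completely join-irreducible if for every subset $S$ of $L$, $x=\bigvee S$ implies $x\in S$. *)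

theory Defs
  imports "HOL-Algebra.Complete_Lattice"
begin

text \<open>For a relation \<open>R \<subseteq> U \<times> U\<close> and \<open>x \<in> U\<close>, the sets \<open>R(x)\<close> and \<open>R\<inverse>(x)\<close> are the relational
  images \<open>R `` {x}\<close> and \<open>R\<inverse> `` {x}\<close>. A quasiorder on \<open>U\<close> is \<open>preorder_on U R\<close>, which includes
  \<open>R \<subseteq> U \<times> U\<close>.\<close>

definition lower_approx :: "'a set \<Rightarrow> 'a rel \<Rightarrow> 'a set \<Rightarrow> 'a set" where
  "lower_approx U R X = {x \<in> U. R `` {x} \<subseteq> X}"

definition upper_approx :: "'a set \<Rightarrow> 'a rel \<Rightarrow> 'a set \<Rightarrow> 'a set" where
  "upper_approx U R X = {x \<in> U. R `` {x} \<inter> X \<noteq> {}}"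

text \<open>The white-triangle operator, that is, the upper approximation with respect to \<open>R\<inverse>\<close>.\<close>

definition inv_upper_approx :: "'a set \<Rightarrow> 'a rel \<Rightarrow> 'a set \<Rightarrow> 'a set" where
  "inv_upper_approx U R X = {x \<in> U. R\<inverse> `` {x} \<inter> X \<noteq> {}}"

definition rough_set :: "'a set \<Rightarrow> 'a rel \<Rightarrow> 'a set \<Rightarrow> 'a set \<times> 'a set" where
  "rough_set U R X = (lower_approx U R X, upper_approx U R X)"

definition rough_sets :: "'a set \<Rightarrow> 'a rel \<Rightarrow> ('a set \<times> 'a set) gorder" where
  "rough_sets U R =
     \<lparr>carrier = {rough_set U R X | X. X \<subseteq> U},
      eq = (=),
      le = (\<lambda>p q. fst p \<subseteq> fst q \<and> snd p \<subseteq> snd q)\<rparr>"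

text \<open>The equation \<open>x = \<Squnion>S\<close> is rendered by \<^term>\<open>is_lub L x S\<close>. The two agree in every complete
  lattice, and the latter does not involve the arbitrary value that the choice operator in the
  definition of \<open>\<Squnion>\<close> returns when no supremum exists.\<close>

definition completely_join_irreducible :: "('a, 'b) gorder_scheme \<Rightarrow> 'a \<Rightarrow> bool" where
  "completely_join_irreducible L x \<longleftrightarrow>
     x \<in> carrier L \<and> (\<forall>S. S \<subseteq> carrier L \<and> is_lub L x S \<longrightarrow> x \<in> S)"

text \<open>The condition \<open>|R(x)| \<ge> 2\<close> must also admit infinite \<open>R(x)\<close>, whose \<^term>\<open>card\<close> is \<open>0\<close>.\<close>

definition rough_irreducibles :: "'a set \<Rightarrow> 'a rel \<Rightarrow> ('a set \<times> 'a set) set" where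
  "rough_irreducibles U R =
     {({}, upper_approx U R {x}) | x.
        x \<in> U \<and> (infinite (R `` {x}) \<or> card (R `` {x}) \<ge> 2)} \<union>
     {(inv_upper_approx U R {x}, upper_approx U R (inv_upper_approx U R {x})) | x. x \<in> U}"

end

theory Submission
  imports Defs
begin

text \<open>In a quasiorder \<open>R(y) \<subseteq> X\<close> and \<open>R(y) \<inter> X \<noteq> \<emptyset>\<close> are statements about the up-set generated by
  \<open>y\<close>, and two extreme rough sets belong to every point \<open>x\<close>. Among all rough sets whose upper part
  omits \<open>x\<close> there is a greatest one, that of \<open>U - R(x)\<close>; among all rough sets whose lower part omits
  \<open>x\<close> there is a greatest one, that of \<open>U - {x}\<close>. A family of rough sets that all omit \<open>x\<close> in one
  part is therefore bounded by a rough set that omits it there too, so that a point in the lower or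
  upper part of a join already lies in that part of some joinand (\<open>in_fst_lub\<close>,
  \<open>in_snd_lub\<close>).

  Dually, the members of \<open>\<J>\<close> are least rough sets that contain a given point: \<open>\<A>(R(x))\<close> is the
  least one with \<open>x\<close> in its lower part, and \<open>({}, R\<inverse>(x))\<close> has the least upper part that contains
  \<open>x\<close>, together with the empty lower part. When such an element is a join, \<open>x\<close> lies in the same part
  of some joinand, which lies below the join and by leastness also above it. Hence every member of \<open>\<J>\<close> is completely
  join-irreducible.

  Conversely, every rough set is the join of the members of \<open>\<J>\<close> below it
  (\<open>rough_set_is_lub_of_irreducibles\<close>): each point of its lower or upper part is witnessed by such
  a member. A completely join-irreducible rough set must then be one of the members of \<open>\<J>\<close> whose join
  it is.\<close>

section \<open>Approximations in a quasiorder\<close>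

lemma rough_sets_simps:
  "carrier (rough_sets U R) = {rough_set U R X | X. X \<subseteq> U}"
  "le (rough_sets U R) p q \<longleftrightarrow> fst p \<subseteq> fst q \<and> snd p \<subseteq> snd q"
  by (auto simp: rough_sets_def)

lemma is_lub_rough_sets_iff:
  assumes "S \<subseteq> carrier (rough_sets U R)"
  shows "is_lub (rough_sets U R) p S \<longleftrightarrow>
    p \<in> carrier (rough_sets U R) \<and> (\<forall>s\<in>S. fst s \<subseteq> fst p \<and> snd s \<subseteq> snd p) \<and>
    (\<forall>q\<in>carrier (rough_sets U R). (\<forall>s\<in>S. fst s \<subseteq> fst q \<and> snd s \<subseteq> snd q) \<longrightarrow>
       fst p \<subseteq> fst q \<and> snd p \<subseteq> snd q)"
proof -
  have "Upper (rough_sets U R) S =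
      {q \<in> carrier (rough_sets U R). \<forall>s\<in>S. fst s \<subseteq> fst q \<and> snd s \<subseteq> snd q}"
    using assms unfolding Upper_def rough_sets_simps(2) Int_absorb2[OF assms] Ball_def Collect_conj_eq
    by (simp add: Int_commute)
  then show ?thesis
    by (simp only: least_def rough_sets_simps(2) Collect_restrict mem_Collect_eq simp_thms
        conj_assoc imp_conjL Ball_def)
qed

lemma rough_set_mono:
  assumes "X \<subseteq> Y"
  shows "fst (rough_set U R X) \<subseteq> fst (rough_set U R Y)"
    and "snd (rough_set U R X) \<subseteq> snd (rough_set U R Y)"
  using assms by (auto simp: rough_set_def lower_approx_def upper_approx_def)

context
  fixes U :: "'a set" and R :: "'a rel"
  assumes quasiorder: "preorder_on U R"
begin

lemma field_R: "(x, y) \<in> R \<Longrightarrow> x \<in> U \<and> y \<in> U"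
  using quasiorder by (auto simp: preorder_on_def refl_on_def)

lemma refl_R: "x \<in> U \<Longrightarrow> (x, x) \<in> R"
  using quasiorder by (auto simp: preorder_on_def refl_on_def)

lemma trans_R: "(x, y) \<in> R \<Longrightarrow> (y, z) \<in> R \<Longrightarrow> (x, z) \<in> R"
  using quasiorder unfolding preorder_on_def by (blast dest: transD)

lemma fst_rough_set_iff: "x \<in> fst (rough_set U R X) \<longleftrightarrow> x \<in> U \<and> R `` {x} \<subseteq> X"
  by (simp add: rough_set_def lower_approx_def)

lemma snd_rough_set_iff: "x \<in> snd (rough_set U R X) \<longleftrightarrow> (\<exists>y\<in>X. (x, y) \<in> R)"
  by (auto simp: rough_set_def upper_approx_def dest: field_R)

lemma inv_upper_approx_singleton: "inv_upper_approx U R {x} = R `` {x}"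
  by (auto simp: inv_upper_approx_def dest: field_R)

lemma rough_set_successors:
  "rough_set U R (R `` {x}) =
    (inv_upper_approx U R {x}, upper_approx U R (inv_upper_approx U R {x}))"
proof -
  have "lower_approx U R (R `` {x}) = R `` {x}"
    using field_R refl_R trans_R unfolding lower_approx_def by blast
  then show ?thesis by (simp add: rough_set_def inv_upper_approx_singleton)
qed

lemma rough_set_singleton:
  assumes "x \<in> U" "R `` {x} \<noteq> {x}"
  shows "rough_set U R {x} = ({}, upper_approx U R {x})"
proof -
  have False if "y \<in> U" "R `` {y} \<subseteq> {x}" for y
  proof -
    \<comment> \<open>Reflexivity puts \<open>y\<close> itself into \<open>R(y)\<close>, which forces \<open>y = x\<close>.\<close>
    have "y = x" using that refl_R[of y] by auto
    then show False using that assms refl_R[of x] by auto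
  qed
  then show ?thesis by (auto simp: rough_set_def lower_approx_def)
qed

text \<open>Since \<open>x \<in> R(x)\<close>, the condition \<open>|R(x)| \<ge> 2\<close> only excludes that \<open>R(x)\<close> is \<open>{x}\<close>.\<close>

lemma at_least_two_successors_iff:
  assumes "x \<in> U"
  shows "infinite (R `` {x}) \<or> card (R `` {x}) \<ge> 2 \<longleftrightarrow> R `` {x} \<noteq> {x}"
proof -
  have x: "x \<in> R `` {x}" using refl_R[OF assms] by simp
  have "R `` {x} = {x}" if "finite (R `` {x})" "\<not> card (R `` {x}) \<ge> 2"
  proof -
    from that x have "card (R `` {x}) = 1"
      using card_gt_0_iff[of "R `` {x}"] by fastforce
    with x show ?thesis by (metis card_1_singletonE singletonD)
  qed
  then show ?thesis by auto
qed

text \<open>In this form every member of \<open>\<J>\<close> is visibly a rough set, and both kinds can be compared with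
  other rough sets by monotonicity.\<close>

lemma rough_irreducibles_eq:
  "rough_irreducibles U R =
    {rough_set U R {x} | x. x \<in> U \<and> R `` {x} \<noteq> {x}} \<union> {rough_set U R (R `` {x}) | x. x \<in> U}"
  (is "_ = ?A \<union> ?B")
proof -
  have "{({}, upper_approx U R {x}) | x. x \<in> U \<and> (infinite (R `` {x}) \<or> card (R `` {x}) \<ge> 2)} = ?A"
    using at_least_two_successors_iff rough_set_singleton by (intro Collect_cong) metis
  then show ?thesis
    unfolding rough_irreducibles_def rough_set_successors by simp
qed

lemma rough_irreducibles_subset_carrier:
  "rough_irreducibles U R \<subseteq> carrier (rough_sets U R)"
  unfolding rough_irreducibles_eq rough_sets_simps(1) by (auto dest: field_R)


section \<open>Points in the parts of a join\<close>

text \<open>The rough set of \<open>U - {x}\<close> is an upper bound of all rough sets without \<open>x\<close> in their lower part.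
  For the upper parts this needs an argument when \<open>X\<close> meets \<open>R(y)\<close> only in \<open>x\<close>: since \<open>R(x)\<close> is not
  contained in \<open>X\<close>, it has an element other than \<open>x\<close>, and that element lies above \<open>y\<close> as well.\<close>

lemma rough_set_le_remove_point:
  assumes "X \<subseteq> U" "x \<in> U" "x \<notin> fst (rough_set U R X)"
  shows "fst (rough_set U R X) \<subseteq> fst (rough_set U R (U - {x}))"
    and "snd (rough_set U R X) \<subseteq> snd (rough_set U R (U - {x}))"
proof -
  obtain w where w: "(x, w) \<in> R" "w \<notin> X"
    using assms by (auto simp: fst_rough_set_iff)
  show "fst (rough_set U R X) \<subseteq> fst (rough_set U R (U - {x}))"
  proof
    fix y assume y: "y \<in> fst (rough_set U R X)"
    then have "(y, x) \<notin> R" using w trans_R by (auto simp: fst_rough_set_iff)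
    with y show "y \<in> fst (rough_set U R (U - {x}))"
      by (auto simp: fst_rough_set_iff dest: field_R)
  qed
  show "snd (rough_set U R X) \<subseteq> snd (rough_set U R (U - {x}))"
  proof
    fix y assume "y \<in> snd (rough_set U R X)"
    then obtain z where z: "z \<in> X" "(y, z) \<in> R" by (auto simp: snd_rough_set_iff)
    show "y \<in> snd (rough_set U R (U - {x}))"
    proof (cases "z = x")
      case True
      then have "w \<noteq> x" "(y, w) \<in> R" using z w trans_R by auto
      then show ?thesis using w field_R by (auto simp: snd_rough_set_iff)
    next
      case False
      then show ?thesis using z assms(1) by (auto simp: snd_rough_set_iff)
    qed
  qed
qed

lemma in_fst_lub:
  assumes S: "S \<subseteq> carrier (rough_sets U R)" and lub: "is_lub (rough_sets U R) p S"
    and x: "x \<in> fst p"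
  shows "\<exists>s\<in>S. x \<in> fst s"
proof (rule ccontr)
  assume none: "\<not> (\<exists>s\<in>S. x \<in> fst s)"
  let ?q = "rough_set U R (U - {x})"
  have "x \<in> U" using lub x
    by (auto simp: is_lub_rough_sets_iff[OF S] rough_sets_simps fst_rough_set_iff)
  have "fst s \<subseteq> fst ?q \<and> snd s \<subseteq> snd ?q" if s: "s \<in> S" for s
  proof -
    obtain X where "X \<subseteq> U" "s = rough_set U R X"
      using S s by (auto simp: rough_sets_simps)
    then show ?thesis using rough_set_le_remove_point \<open>x \<in> U\<close> none s by metis
  qed
  moreover have "?q \<in> carrier (rough_sets U R)" by (auto simp: rough_sets_simps)
  ultimately have "fst p \<subseteq> fst ?q" using lub by (simp add: is_lub_rough_sets_iff[OF S])
  then have "x \<in> fst ?q" using x by blast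
  then show False using refl_R[OF \<open>x \<in> U\<close>] by (auto simp: fst_rough_set_iff)
qed

text \<open>Here the bound is the rough set of \<open>U - R(x)\<close>: the upper part of the rough set of \<open>X\<close> omits \<open>x\<close>
  exactly if \<open>X\<close> is disjoint from \<open>R(x)\<close>.\<close>

lemma in_snd_lub:
  assumes S: "S \<subseteq> carrier (rough_sets U R)" and lub: "is_lub (rough_sets U R) p S"
    and x: "x \<in> snd p"
  shows "\<exists>s\<in>S. x \<in> snd s"
proof (rule ccontr)
  assume none: "\<not> (\<exists>s\<in>S. x \<in> snd s)"
  let ?q = "rough_set U R (U - R `` {x})"
  have "fst s \<subseteq> fst ?q \<and> snd s \<subseteq> snd ?q" if s: "s \<in> S" for s
  proof -
    obtain X where X: "X \<subseteq> U" "s = rough_set U R X"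
      using S s by (auto simp: rough_sets_simps)
    then have "X \<subseteq> U - R `` {x}" using none s by (auto simp: snd_rough_set_iff)
    then show ?thesis using rough_set_mono X by metis
  qed
  moreover have "?q \<in> carrier (rough_sets U R)" by (auto simp: rough_sets_simps)
  ultimately have "snd p \<subseteq> snd ?q" using lub by (simp add: is_lub_rough_sets_iff[OF S])
  then show False using x by (auto simp: snd_rough_set_iff)
qed


section \<open>The completely join-irreducible elements\<close>

lemma rough_set_singleton_irreducible:
  assumes x: "x \<in> U" "R `` {x} \<noteq> {x}"
  shows "completely_join_irreducible (rough_sets U R) (rough_set U R {x})"
    (is "completely_join_irreducible _ ?p")
  unfolding completely_join_irreducible_def
proof (intro conjI allI impI)
  show "?p \<in> carrier (rough_sets U R)" using x by (auto simp: rough_sets_simps)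
  fix S assume "S \<subseteq> carrier (rough_sets U R) \<and> is_lub (rough_sets U R) ?p S"
  then have S: "S \<subseteq> carrier (rough_sets U R)" and lub: "is_lub (rough_sets U R) ?p S" by auto
  have "x \<in> snd ?p" using x refl_R by (auto simp: snd_rough_set_iff)
  then obtain s where s: "s \<in> S" "x \<in> snd s" using in_snd_lub[OF S lub] by blast
  then have le: "fst s \<subseteq> fst ?p" "snd s \<subseteq> snd ?p"
    using lub by (auto simp: is_lub_rough_sets_iff[OF S])
  have "fst ?p = {}" using rough_set_singleton[OF x] by simp
  moreover have "snd ?p \<subseteq> snd s"
  proof -
    obtain X where X: "s = rough_set U R X" using S s by (auto simp: rough_sets_simps)
    with s obtain y where y: "y \<in> X" "(x, y) \<in> R" by (auto simp: snd_rough_set_iff)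
    show ?thesis
    proof
      fix z assume "z \<in> snd ?p"
      then have "(z, x) \<in> R" by (simp add: snd_rough_set_iff)
      then show "z \<in> snd s" using y trans_R unfolding X snd_rough_set_iff by blast
    qed
  qed
  ultimately have "s = ?p" using le by (auto intro: prod_eqI)
  with s show "?p \<in> S" by simp
qed

lemma rough_set_successors_irreducible:
  assumes x: "x \<in> U"
  shows "completely_join_irreducible (rough_sets U R) (rough_set U R (R `` {x}))"
    (is "completely_join_irreducible _ ?p")
  unfolding completely_join_irreducible_def
proof (intro conjI allI impI)
  show "?p \<in> carrier (rough_sets U R)" by (auto simp: rough_sets_simps dest: field_R)
  fix S assume "S \<subseteq> carrier (rough_sets U R) \<and> is_lub (rough_sets U R) ?p S"
  then have S: "S \<subseteq> carrier (rough_sets U R)" and lub: "is_lub (rough_sets U R) ?p S" by auto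
  have "x \<in> fst ?p" using x by (simp add: fst_rough_set_iff)
  then obtain s where s: "s \<in> S" "x \<in> fst s" using in_fst_lub[OF S lub] by blast
  then have le: "fst s \<subseteq> fst ?p" "snd s \<subseteq> snd ?p"
    using lub by (auto simp: is_lub_rough_sets_iff[OF S])
  obtain X where X: "s = rough_set U R X" using S s by (auto simp: rough_sets_simps)
  then have "R `` {x} \<subseteq> X" using s by (simp add: fst_rough_set_iff)
  then have "fst ?p \<subseteq> fst s" "snd ?p \<subseteq> snd s" unfolding X by (rule rough_set_mono)+
  then have "s = ?p" using le by (auto intro: prod_eqI)
  with s show "?p \<in> S" by simp
qed

text \<open>A point \<open>y\<close> in the upper part of the rough set of \<open>X\<close> has some \<open>z \<in> X\<close> above it. If \<open>z\<close> has a
  successor other than itself, then \<open>\<A>({z}) \<in> \<J>\<close> witnesses \<open>y\<close>; otherwise \<open>R(z) = {z}\<close>, so that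
  \<open>\<A>({z}) = \<A>(R(z))\<close> is a member of \<open>\<J>\<close> all the same.\<close>

lemma rough_set_is_lub_of_irreducibles:
  assumes p: "p \<in> carrier (rough_sets U R)"
  shows "is_lub (rough_sets U R) p {j \<in> rough_irreducibles U R. fst j \<subseteq> fst p \<and> snd j \<subseteq> snd p}"
    (is "is_lub _ p ?S")
proof -
  have S: "?S \<subseteq> carrier (rough_sets U R)" using rough_irreducibles_subset_carrier by auto
  obtain X where X: "X \<subseteq> U" "p = rough_set U R X" using p by (auto simp: rough_sets_simps)
  have "fst p \<subseteq> fst q \<and> snd p \<subseteq> snd q"
    if ub: "\<forall>s\<in>?S. fst s \<subseteq> fst q \<and> snd s \<subseteq> snd q" for q
  proof (intro conjI subsetI)
    fix y assume "y \<in> fst p"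
    then have y: "y \<in> U" "R `` {y} \<subseteq> X" by (auto simp: X fst_rough_set_iff)
    then have "rough_set U R (R `` {y}) \<in> ?S"
      using rough_set_mono[OF y(2)] unfolding rough_irreducibles_eq X by blast
    moreover have "y \<in> fst (rough_set U R (R `` {y}))" using y by (simp add: fst_rough_set_iff)
    ultimately show "y \<in> fst q" using ub by blast
  next
    fix y assume "y \<in> snd p"
    then obtain z where z: "z \<in> X" "(y, z) \<in> R" by (auto simp: X snd_rough_set_iff)
    then have "z \<in> U" using X by auto
    then have "rough_set U R {z} \<in> rough_irreducibles U R"
      unfolding rough_irreducibles_eq by (cases "R `` {z} = {z}") (force, blast)
    then have "rough_set U R {z} \<in> ?S"
      using rough_set_mono[of "{z}" X] z by (auto simp: X)
    moreover have "y \<in> snd (rough_set U R {z})" using z by (simp add: snd_rough_set_iff)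
    ultimately show "y \<in> snd q" using ub by blast
  qed
  then show ?thesis using p by (auto simp: is_lub_rough_sets_iff[OF S])
qed

end

theorem theorem5p2:
  fixes U :: "'a set" and R :: "'a rel"
  assumes "U \<noteq> {}" and "preorder_on U R"
  shows "rough_irreducibles U R = {p. completely_join_irreducible (rough_sets U R) p} \<and>
    (\<forall>p \<in> carrier (rough_sets U R). p \<noteq> ({}, {}) \<longrightarrow>
       (\<exists>S \<subseteq> rough_irreducibles U R. is_lub (rough_sets U R) p S))"
proof (intro conjI ballI impI)
  note qo = \<open>preorder_on U R\<close>
  let ?S = "\<lambda>p. {j \<in> rough_irreducibles U R. fst j \<subseteq> fst p \<and> snd j \<subseteq> snd p}"
  show "rough_irreducibles U R = {p. completely_join_irreducible (rough_sets U R) p}"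
  proof (intro equalityI subsetI)
    fix p assume "p \<in> rough_irreducibles U R"
    then show "p \<in> {p. completely_join_irreducible (rough_sets U R) p}"
      using rough_set_singleton_irreducible[OF qo] rough_set_successors_irreducible[OF qo]
      unfolding rough_irreducibles_eq[OF qo] by blast
  next
    fix p assume "p \<in> {p. completely_join_irreducible (rough_sets U R) p}"
    then have p: "p \<in> carrier (rough_sets U R)"
      and irr: "\<And>S. S \<subseteq> carrier (rough_sets U R) \<Longrightarrow> is_lub (rough_sets U R) p S \<Longrightarrow> p \<in> S"
      by (auto simp: completely_join_irreducible_def)
    have "?S p \<subseteq> carrier (rough_sets U R)"
      using rough_irreducibles_subset_carrier[OF qo] by auto
    then have "p \<in> ?S p" using rough_set_is_lub_of_irreducibles[OF qo p] by (rule irr)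
    then show "p \<in> rough_irreducibles U R" by simp
  qed
  fix p assume "p \<in> carrier (rough_sets U R)"
  then show "\<exists>S \<subseteq> rough_irreducibles U R. is_lub (rough_sets U R) p S"
    by (intro exI[of _ "?S p"] conjI rough_set_is_lub_of_irreducibles[OF qo]) auto
qed

end
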